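(* Let $(P,\lambda)$ be a marked poset with all minimal elements of $P$ marked, and let $t\in(0,1)^{\tilde P}$. Then the vertices of $\mathcal{O}_t(P,\lambda)$ are exactly the vertices (zero-dimensional cells) of its tropical subdivision $\mathcal{T}_t(P,\lambda)$.
   Context: A marked poset $(P,\lambda)$ consists of a finite poset $P$ together with an order-preserving map $\lambda\colon P^*\to\mathbb{R}$ on an induced subposet $P^*\subseteq P$; elements of $P^*$ are marked and $\tilde P=P\setminus P^*$. Write $p\prec q$ if $q$ covers $p$. For $t\in[0,1]^{\tilde P}$, $\mathcal{O}_t(P,\lambda)\subseteq\mathbb{R}^P$ is the set of $x$ with $x_a=\lambda(a)$ for $a\in P^*$ and, for every saturated chain $p_0\prec p_1\prec\cdots\prec p_r\prec p$ with $p_0\in P^*$, $p_1,\dots,p_r\in\tilde P$, $p\in P$, $r\ge0$: $(1-t_p)(t_{p_1}\cdots t_{p_r}x_{p_0}+t_{p_2}\cdots t_{p_r}x_{p_1}+\cdots+t_{p_r}x_{p_{r-1}}+x_{p_r})\le x_p$, with $t_p:=0$ for $p\in P^*$. The marked order polyhedron is $\mathcal{O}(P,\lambda)=\mathcal{O}_{\mathbf 0}(P,\lambda)$. The transfer map $\varphi_t\colon\mathbb{R}^P\to\mathbb{R}^P$ is $\varphi_t(x)_p=x_p$ for $p\in P^*$ and $\varphi_t(x)_p=x_p-t_p\max_{q\prec p}x_q$ for $p\in\tilde P$; it maps $\mathcal{O}(P,\lambda)$ bijectively onto $\mathcal{O}_t(P,\lambda)$. Let $R\subseteq\tilde P$ be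 the set of unmarked elements covering at least two elements. For $x\in\mathbb{R}^P$ and $r\in R$ let $\mathrm{tc}(x)_r=\operatorname{argmax}_{q\prec r}x_q$ (the set of $q\prec r$ attaining the maximum). For each $x$, with $\tau=\mathrm{tc}(x)$, the associated cell is $G_\tau=\{y\in\mathbb{R}^P:\tau_r\subseteq\mathrm{tc}(y)_r\text{ for all }r\in R\}$; these cells (together with $\varnothing$) form a polyhedral subdivision $\mathcal{T}(\mathcal{H}(P,\lambda))$ of $\mathbb{R}^P$ (the one induced by the tropical hyperplane arrangement of the tropical linear forms $\max_{q\prec r}x_q$, $r\in R$). The tropical subdivision of $\mathcal{O}(P,\lambda)$ is $\mathcal{T}(P,\lambda)=\{F\cap G: F\text{ a face of }\mathcal{O}(P,\lambda),\ G\text{ a cell of }\mathcal{T}(\mathcal{H}(P,\lambda))\}$, and the tropical subdivision of $\mathcal{O}_t(P,\lambda)$ is $\mathcal{T}_t(P,\lambda)=\{\varphi_t(Q):Q\in\mathcal{T}(P,\lambda)\}$ (a polyhedral subdivision, since $\varphi_t$ is linear on each $Q$). *)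

theory Defs
  imports "HOL-Analysis.Analysis"
begin

text \<open>
  The poset \<open>P\<close> is a finite type \<open>'p\<close> of class \<open>order\<close>. A marking is given by the set
  \<open>M\<close> of marked elements and a function \<open>lam\<close>, of which only the values on \<open>M\<close> are used.
  The parameter \<open>t\<close> is likewise only used outside \<open>M\<close>.
\<close>

definition covered_by :: "'p::order \<Rightarrow> 'p \<Rightarrow> bool" (infix \<open>\<prec>\<^sub>c\<close> 50) where
  "p \<prec>\<^sub>c q \<longleftrightarrow> p < q \<and> (\<nexists>z. p < z \<and> z < q)"

definition param :: "'p set \<Rightarrow> ('p \<Rightarrow> real) \<Rightarrow> 'p \<Rightarrow> real" where
  "param M t p = (if p \<in> M then 0 else t p)"

text \<open>
  A saturated chain \<open>p\<^sub>0 \<prec> p\<^sub>1 \<prec> \<dots> \<prec> p\<^sub>r \<prec> p\<close> with \<open>p\<^sub>0\<close> marked and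
  \<open>p\<^sub>1, \<dots>, p\<^sub>r\<close> unmarked is represented by the list \<open>ps = [p\<^sub>0, \<dots>, p\<^sub>r]\<close>
  and its end point \<open>p\<close>.
\<close>

definition marked_chain :: "'p::order set \<Rightarrow> 'p list \<Rightarrow> 'p \<Rightarrow> bool" where
  "marked_chain M ps p \<longleftrightarrow>
     ps \<noteq> [] \<and> hd ps \<in> M \<and> set (tl ps) \<inter> M = {} \<and> successively (\<prec>\<^sub>c) (ps @ [p])"

definition marked_poset_polyhedron ::
    "'p set \<Rightarrow> ('p \<Rightarrow> real) \<Rightarrow> ('p \<Rightarrow> real) \<Rightarrow> (real^'p::{finite,order}) set" where
  "marked_poset_polyhedron M lam t =
     {x. (\<forall>a\<in>M. x $ a = lam a) \<and>
         (\<forall>ps p. marked_chain M ps p \<longrightarrow>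
            (1 - param M t p) *
              (\<Sum>i<length ps. (\<Prod>j\<in>{i<..<length ps}. param M t (ps ! j)) * x $ (ps ! i))
            \<le> x $ p)}"

definition marked_order_polyhedron ::
    "'p set \<Rightarrow> ('p \<Rightarrow> real) \<Rightarrow> (real^'p::{finite,order}) set" where
  "marked_order_polyhedron M lam = marked_poset_polyhedron M lam (\<lambda>_. 0)"

text \<open>
  The maximum is over a nonempty set whenever \<open>p\<close> is not minimal, in particular for all
  unmarked \<open>p\<close> if all minimal elements are marked.
\<close>

definition transfer_map ::
    "'p set \<Rightarrow> ('p \<Rightarrow> real) \<Rightarrow> real^'p::{finite,order} \<Rightarrow> real^'p::{finite,order}" where
  "transfer_map M t x =
     (\<chi> p. if p \<in> M then x $ p else x $ p - t p * Max ((\<lambda>q. x $ q) ` {q. q \<prec>\<^sub>c p}))"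

definition branch_elements :: "'p::{finite,order} set \<Rightarrow> 'p set" where
  "branch_elements M = {r. r \<notin> M \<and> card {q. q \<prec>\<^sub>c r} \<ge> 2}"

definition tc :: "real^'p::{finite,order} \<Rightarrow> 'p \<Rightarrow> 'p set" where
  "tc x r = {q. is_arg_max (\<lambda>q. x $ q) (\<lambda>q. q \<prec>\<^sub>c r) q}"

definition tropical_cell ::
    "'p set \<Rightarrow> ('p \<Rightarrow> 'p set) \<Rightarrow> (real^'p::{finite,order}) set" where
  "tropical_cell M \<tau> = {y. \<forall>r\<in>branch_elements M. \<tau> r \<subseteq> tc y r}"

definition tropical_arrangement_subdivision ::
    "'p set \<Rightarrow> (real^'p::{finite,order}) set set" where
  "tropical_arrangement_subdivision M = insert {} (range (\<lambda>x. tropical_cell M (tc x)))"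

definition tropical_subdivision_order ::
    "'p set \<Rightarrow> ('p \<Rightarrow> real) \<Rightarrow> (real^'p::{finite,order}) set set" where
  "tropical_subdivision_order M lam =
     {F \<inter> G | F G. F face_of marked_order_polyhedron M lam
                  \<and> G \<in> tropical_arrangement_subdivision M}"

definition tropical_subdivision ::
    "'p set \<Rightarrow> ('p \<Rightarrow> real) \<Rightarrow> ('p \<Rightarrow> real) \<Rightarrow> (real^'p::{finite,order}) set set" where
  "tropical_subdivision M lam t =
     (\<lambda>Q. transfer_map M t ` Q) ` tropical_subdivision_order M lam"

end

theory Submission
  imports Defs
begin

text \<open>
  A point \<open>x\<close> of the order polyhedron is a vertex of the tropical subdivision iff it is \<^emph>\<open>rigid\<close>:
  the zero vector is the only direction \<open>w\<close> that vanishes on marked elements, is constant along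
  tight covering relations and is constant on every argmax set of \<open>x\<close>. Near \<open>x\<close> the transfer map is
  affine in such directions, so a nonzero one yields a segment through the image point inside the
  target polyhedron. Conversely, let the image of a rigid \<open>x\<close> be \<open>(1 - u) a + u b\<close> with preimages
  \<open>A\<close>, \<open>B\<close> of \<open>a\<close>, \<open>b\<close>. The inverse transfer map is coordinatewise convex, so \<open>x \<le> (1 - u) A + u B\<close>.
  Equality holds below each tight covering relation (because \<open>t < 1\<close>) and is inherited from \<open>p\<close> by
  the argmax elements below \<open>p\<close> (because \<open>t > 0\<close>); rigidity ensures that this reaches every
  element. Then \<open>A - B\<close> is such a direction, so \<open>A = B\<close>.
\<close>

subsection \<open>Argmax sets and perturbations\<close>

lemma tc_iff: "q \<in> tc x r \<longleftrightarrow> q \<prec>\<^sub>c r \<and> (\<forall>q'. q' \<prec>\<^sub>c r \<longrightarrow> x $ q' \<le> x $ q)"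
  by (auto simp: tc_def is_arg_max_linorder)

lemma wf_less_finite: "wf {(q, p :: 'p::{finite,order}). q < p}"
proof (rule wf_subset[OF wf_measure])
  show "{(q, p :: 'p). q < p} \<subseteq> Wellfounded.measure (\<lambda>p. card {z. z < p})"
    by (auto intro!: psubset_card_mono)
qed

lemma wf_greater_finite: "wf {(q, p :: 'p::{finite,order}). p < q}"
proof (rule wf_subset[OF wf_measure])
  show "{(q, p :: 'p). p < q} \<subseteq> Wellfounded.measure (\<lambda>p. card {z. p < z})"
    by (auto intro!: psubset_card_mono)
qed

lemma order_induct:
  fixes p :: "'p::{finite,order}"
  assumes "\<And>p. (\<And>q. q < p \<Longrightarrow> Q q) \<Longrightarrow> Q p"
  shows "Q p"
  using wf_less_finite by (induction p rule: wf_induct_rule) (rule assms, simp)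

lemma order_induct_up:
  fixes p :: "'p::{finite,order}"
  assumes "\<And>p. (\<And>q. p < q \<Longrightarrow> Q q) \<Longrightarrow> Q p"
  shows "Q p"
  using wf_greater_finite by (induction p rule: wf_induct_rule) (rule assms, simp)

lemma exists_lower_cover:
  fixes p :: "'p::{finite,order}"
  assumes "q < p"
  shows "\<exists>z. z \<prec>\<^sub>c p"
proof -
  have "finite {z. z < p}" "{z. z < p} \<noteq> {}" using assms by auto
  then obtain z where "z \<in> {z. z < p}" "\<forall>b\<in>{z. z < p}. z \<le> b \<longrightarrow> z = b"
    using finite_has_maximal by blast
  then have "z \<prec>\<^sub>c p" unfolding covered_by_def by auto
  then show ?thesis ..
qed

lemma tc_nonempty:
  assumes "q \<prec>\<^sub>c p"
  shows "\<exists>q. q \<in> tc x p"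
proof -
  let ?S = "{q. q \<prec>\<^sub>c p}"
  have "Max ((\<lambda>q. x $ q) ` ?S) \<in> (\<lambda>q. x $ q) ` ?S"
    using assms by (intro Max_in) auto
  then obtain z where z: "z \<prec>\<^sub>c p" "x $ z = Max ((\<lambda>q. x $ q) ` ?S)" by auto
  have "x $ q' \<le> x $ z" if "q' \<prec>\<^sub>c p" for q'
    unfolding z(2) using that by (intro Max_ge) auto
  then show ?thesis using z(1) by (auto simp: tc_iff)
qed

lemma Max_eq_tc:
  assumes "q \<in> tc x p"
  shows "Max ((\<lambda>q. x $ q) ` {q. q \<prec>\<^sub>c p}) = x $ q"
  using assms by (intro Max_eqI) (auto simp: tc_iff)

lemma transfer_map_tc:
  "p \<notin> M \<Longrightarrow> q \<in> tc x p \<Longrightarrow> transfer_map M t x $ p = x $ p - t p * x $ q"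
  by (simp add: transfer_map_def Max_eq_tc)

lemma transfer_map_marked: "p \<in> M \<Longrightarrow> transfer_map M t x $ p = x $ p"
  by (simp add: transfer_map_def)

lemma transfer_map_le:
  assumes "p \<notin> M" "q \<prec>\<^sub>c p" "0 \<le> t p"
  shows "transfer_map M t x $ p \<le> x $ p - t p * x $ q"
proof -
  obtain z where z: "z \<in> tc x p" using tc_nonempty assms(2) by blast
  then have "x $ q \<le> x $ z" using assms(2) by (auto simp: tc_iff)
  then show ?thesis using transfer_map_tc[OF assms(1) z] assms(3) by (simp add: mult_left_mono)
qed

lemma transfer_map_zero: "transfer_map M (\<lambda>_. 0) x = x"
  by (simp add: transfer_map_def vec_eq_iff)

text \<open>Each strict inequality between coordinates is an open condition on \<open>s\<close> at
  0, and there are only finitely many pairs, so one \<open>e\<close> serves for all of them.\<close>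

lemma strict_order_stable:
  fixes x w :: "real^'p::finite"
  shows "\<exists>e>0. \<forall>s. \<bar>s\<bar> \<le> e \<longrightarrow>
    (\<forall>q p. x $ q < x $ p \<longrightarrow> (x + s *\<^sub>R w) $ q < (x + s *\<^sub>R w) $ p)"
proof -
  have "\<forall>\<^sub>F s in nhds 0. x $ q < x $ p \<longrightarrow> (x + s *\<^sub>R w) $ q < (x + s *\<^sub>R w) $ p" for q p
  proof (cases "x $ q < x $ p")
    case True
    have "((\<lambda>s. (x + s *\<^sub>R w) $ p - (x + s *\<^sub>R w) $ q) \<longlongrightarrow> x $ p - x $ q) (nhds 0)"
      by (auto intro!: tendsto_eq_intros filterlim_ident)
    then have "\<forall>\<^sub>F s in nhds 0. 0 < (x + s *\<^sub>R w) $ p - (x + s *\<^sub>R w) $ q"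
      using True by (intro order_tendstoD(1)) auto
    then show ?thesis by eventually_elim simp
  qed auto
  then have "\<forall>\<^sub>F s in nhds 0. \<forall>q p. x $ q < x $ p \<longrightarrow> (x + s *\<^sub>R w) $ q < (x + s *\<^sub>R w) $ p"
    by (intro eventually_all_finite) auto
  then obtain d where "d > 0" and d: "\<And>s. dist s 0 < d \<Longrightarrow>
      \<forall>q p. x $ q < x $ p \<longrightarrow> (x + s *\<^sub>R w) $ q < (x + s *\<^sub>R w) $ p"
    unfolding eventually_nhds_metric by blast
  then show ?thesis
    by (intro exI[of _ "d / 2"]) (auto simp: dist_real_def)
qed

lemma in_open_segment_symmetric:
  fixes x v :: "'a::euclidean_space"
  assumes "v \<noteq> 0"
  shows "x \<in> open_segment (x + v) (x - v)"
proof -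
  have "midpoint (x + v) (x - v) = x" by (simp add: midpoint_def scaleR_2[symmetric])
  moreover have "x + v \<noteq> x - v"
  proof
    assume "x + v = x - v"
    then have "2 *\<^sub>R v = 0" by (simp add: scaleR_2 algebra_simps)
    then show False using assms by simp
  qed
  ultimately show ?thesis using midpoint_in_open_segment by metis
qed

subsection \<open>Rigid points\<close>

text \<open>For \<open>x\<close> in the order polyhedron, these \<open>w\<close> form the direction
  space of the smallest cell of the tropical subdivision containing \<open>x\<close>. Ranging over
  all unmarked \<open>r\<close> instead of \<open>branch_elements M\<close> adds nothing, because an
  element with at most one lower cover has at most one argmax.\<close>

definition compatible ::
    "'p set \<Rightarrow> real^'p::{finite,order} \<Rightarrow> real^'p::{finite,order} \<Rightarrow> bool" where
  "compatible M x w \<longleftrightarrow> (\<forall>a\<in>M. w $ a = 0)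
     \<and> (\<forall>q p. q \<prec>\<^sub>c p \<longrightarrow> x $ q = x $ p \<longrightarrow> w $ q = w $ p)
     \<and> (\<forall>r. r \<notin> M \<longrightarrow> (\<forall>q\<in>tc x r. \<forall>q'\<in>tc x r. w $ q = w $ q'))"

definition rigid :: "'p set \<Rightarrow> real^'p::{finite,order} \<Rightarrow> bool" where
  "rigid M x \<longleftrightarrow> (\<forall>w. compatible M x w \<longrightarrow> w = 0)"

text \<open>All argmax elements of \<open>x\<close> move by the same amount, and the lower covers
  strictly below them stay strictly below.\<close>

lemma tc_subset_perturbed:
  assumes w: "compatible M x w" and "r \<notin> M"
    and s: "\<And>q p. x $ q < x $ p \<Longrightarrow> (x + s *\<^sub>R w) $ q < (x + s *\<^sub>R w) $ p"
  shows "tc x r \<subseteq> tc (x + s *\<^sub>R w) r"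
proof
  fix q assume q: "q \<in> tc x r"
  have "(x + s *\<^sub>R w) $ q' \<le> (x + s *\<^sub>R w) $ q" if q': "q' \<prec>\<^sub>c r" for q'
  proof (cases "x $ q' < x $ q")
    case True
    then show ?thesis using s by (intro less_imp_le)
  next
    case False
    then have eq: "x $ q' = x $ q" using q q' by (force simp: tc_iff)
    then have "q' \<in> tc x r" using q q' by (auto simp: tc_iff)
    then have "w $ q' = w $ q" using w q \<open>r \<notin> M\<close> unfolding compatible_def by blast
    then show ?thesis using eq by simp
  qed
  then show "q \<in> tc (x + s *\<^sub>R w) r" using q by (simp add: tc_iff)
qed

text \<open>The test direction is the unit vector at \<open>r\<close>. Rigidity makes it violate
  some clause of \<open>compatible\<close>, and the violated clause must involve \<open>r\<close>,
  the only coordinate where the vector is nonzero.\<close>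

lemma rigid_unmarked_edge:
  assumes "rigid M x" "r \<notin> M"
  obtains p where "p \<prec>\<^sub>c r" "x $ p = x $ r"
  | p where "r \<prec>\<^sub>c p" "x $ r = x $ p"
  | s where "s \<notin> M" "r \<in> tc x s"
proof -
  have "axis r (1::real) \<noteq> 0" by simp
  then have "\<not> compatible M x (axis r 1)" using assms(1) by (auto simp: rigid_def)
  then consider "\<exists>a\<in>M. axis r (1::real) $ a \<noteq> 0"
    | "\<exists>q p. q \<prec>\<^sub>c p \<and> x $ q = x $ p \<and> axis r (1::real) $ q \<noteq> axis r 1 $ p"
    | "\<exists>s q q'. s \<notin> M \<and> q \<in> tc x s \<and> q' \<in> tc x s \<and> axis r (1::real) $ q \<noteq> axis r 1 $ q'"
    unfolding compatible_def by blast
  then show thesis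
  proof cases
    case 1
    then show ?thesis using assms(2) by (auto simp: axis_def split: if_splits)
  next
    case 2
    then obtain q p where "q \<prec>\<^sub>c p" "x $ q = x $ p" "q = r \<or> p = r"
      by (auto simp: axis_def split: if_splits)
    then show ?thesis using that by auto
  next
    case 3
    then show ?thesis using that(3) by (auto simp: axis_def split: if_splits)
  qed
qed

locale marked_poset =
  fixes M :: "'p::{finite,order} set" and lam :: "'p \<Rightarrow> real"
  assumes minimal_marked: "(\<nexists>q. q < p) \<Longrightarrow> p \<in> M"
begin

lemma unmarked_tc_nonempty: "p \<notin> M \<Longrightarrow> \<exists>q. q \<in> tc x p"
  using minimal_marked exists_lower_cover tc_nonempty by metis

subsection \<open>The transfer map and the chain inequalities\<close>

definition chain_sum :: "('p \<Rightarrow> real) \<Rightarrow> (real, 'p) vec \<Rightarrow> 'p list \<Rightarrow> real" where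
  "chain_sum t y ps =
     (\<Sum>i<length ps. (\<Prod>j\<in>{i<..<length ps}. param M t (ps ! j)) * y $ (ps ! i))"

text \<open>Horner's scheme: appending \<open>q\<close> multiplies every earlier weight by the
  parameter of \<open>q\<close>, while the last entry has the empty product as its weight.\<close>

lemma chain_sum_snoc: "chain_sum t y (ps @ [q]) = param M t q * chain_sum t y ps + y $ q"
proof -
  let ?n = "length ps"
  have *: "(\<Prod>j\<in>{i<..<Suc ?n}. param M t ((ps @ [q]) ! j)) =
      param M t q * (\<Prod>j\<in>{i<..<?n}. param M t (ps ! j))" if "i < ?n" for i
  proof -
    have "{i<..<Suc ?n} = insert ?n {i<..<?n}" using that by auto
    then show ?thesis by (simp add: nth_append)
  qed
  have "(\<Sum>i<?n. (\<Prod>j\<in>{i<..<Suc ?n}. param M t ((ps @ [q]) ! j)) * y $ ((ps @ [q]) ! i)) =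
      (\<Sum>i<?n. param M t q * ((\<Prod>j\<in>{i<..<?n}. param M t (ps ! j)) * y $ (ps ! i)))"
  proof (rule sum.cong[OF refl])
    fix i assume "i \<in> {..<?n}"
    then have i: "i < ?n" by simp
    show "(\<Prod>j\<in>{i<..<Suc ?n}. param M t ((ps @ [q]) ! j)) * y $ ((ps @ [q]) ! i) =
      param M t q * ((\<Prod>j\<in>{i<..<?n}. param M t (ps ! j)) * y $ (ps ! i))"
      unfolding *[OF i] using i by (simp add: nth_append)
  qed
  moreover have "{?n<..<Suc ?n} = {}" by auto
  ultimately show ?thesis
    by (simp add: chain_sum_def sum_distrib_left)
qed

text \<open>Induction along the chain: at an unmarked \<open>q\<close> with predecessor
  \<open>last ps\<close>, \<open>transfer_map_le\<close> absorbs exactly the term that the Horner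
  recursion adds.\<close>

lemma chain_sum_le:
  assumes "\<And>p. p \<notin> M \<Longrightarrow> 0 \<le> t p"
    and "ps \<noteq> []" "hd ps \<in> M" "set (tl ps) \<inter> M = {}" "successively (\<prec>\<^sub>c) ps"
  shows "chain_sum t (transfer_map M t x) ps \<le> x $ last ps"
  using assms(2-)
proof (induction ps rule: rev_induct)
  case (snoc q ps)
  show ?case
  proof (cases "ps = []")
    case True
    then show ?thesis using snoc.prems chain_sum_snoc[of t _ "[]" q]
      by (simp add: chain_sum_def transfer_map_marked)
  next
    case False
    then have q: "q \<notin> M" "last ps \<prec>\<^sub>c q"
      and "chain_sum t (transfer_map M t x) ps \<le> x $ last ps"
      using snoc by (auto simp: successively_append_iff)
    then have "t q * chain_sum t (transfer_map M t x) ps \<le> t q * x $ last ps"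
      using assms(1) by (intro mult_left_mono) auto
    then show ?thesis
      using transfer_map_le[OF q, of t x] assms(1) q by (simp add: chain_sum_snoc param_def)
  qed
qed simp

text \<open>Descending from \<open>p\<close> through argmax elements until a marked one is reached
  turns every estimate of \<open>chain_sum_le\<close> into an equality. For nonnegative
  \<open>t\<close>, \<open>x $ p\<close> is thus the maximum of the chain sums ending at
  \<open>p\<close>, which inverts the transfer map explicitly.\<close>

lemma chain_sum_attained:
  "\<exists>ps. ps \<noteq> [] \<and> hd ps \<in> M \<and> set (tl ps) \<inter> M = {} \<and> successively (\<prec>\<^sub>c) ps
     \<and> last ps = p \<and> chain_sum t (transfer_map M t x) ps = x $ p"
proof (induction p rule: order_induct)
  case (1 p)
  show ?case
  proof (cases "p \<in> M")
    case True
    then show ?thesis using chain_sum_snoc[of t _ "[]" p]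
      by (intro exI[of _ "[p]"]) (simp add: chain_sum_def transfer_map_marked)
  next
    case False
    then obtain q where q: "q \<in> tc x p" using unmarked_tc_nonempty by blast
    then have "q < p" by (simp add: tc_iff covered_by_def)
    then obtain ps where "ps \<noteq> []" "hd ps \<in> M" "set (tl ps) \<inter> M = {}"
      "successively (\<prec>\<^sub>c) ps" "last ps = q" "chain_sum t (transfer_map M t x) ps = x $ q"
      using 1 by blast
    then show ?thesis using q False
      by (intro exI[of _ "ps @ [p]"])
        (auto simp: chain_sum_snoc successively_append_iff tc_iff param_def
          transfer_map_tc[OF False q])
  qed
qed

text \<open>Among the chain inequalities whose last step is a fixed cover
  \<open>q \<prec>\<^sub>c p\<close>, the strongest comes from the largest chain sum ending at
  \<open>q\<close>, which is \<open>x $ q\<close>. One inequality per cover therefore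
  remains.\<close>

lemma transfer_map_in_polyhedron_iff:
  assumes "\<And>p. p \<notin> M \<Longrightarrow> 0 \<le> t p \<and> t p < 1"
  shows "transfer_map M t x \<in> marked_poset_polyhedron M lam t \<longleftrightarrow>
    (\<forall>a\<in>M. x $ a = lam a) \<and>
    (\<forall>q p. q \<prec>\<^sub>c p \<longrightarrow> (1 - param M t p) * x $ q \<le> transfer_map M t x $ p)"
proof -
  let ?y = "transfer_map M t x"
  have "(\<forall>ps p. marked_chain M ps p \<longrightarrow> (1 - param M t p) * chain_sum t ?y ps \<le> ?y $ p) \<longleftrightarrow>
      (\<forall>q p. q \<prec>\<^sub>c p \<longrightarrow> (1 - param M t p) * x $ q \<le> ?y $ p)" (is "?L \<longleftrightarrow> ?R")
  proof
    assume L: ?L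
    show ?R
    proof (intro allI impI)
      fix q p :: 'p assume "q \<prec>\<^sub>c p"
      obtain ps where ps: "ps \<noteq> []" "hd ps \<in> M" "set (tl ps) \<inter> M = {}"
        "successively (\<prec>\<^sub>c) ps" "last ps = q" "chain_sum t ?y ps = x $ q"
        using chain_sum_attained by blast
      then have "marked_chain M ps p"
        using \<open>q \<prec>\<^sub>c p\<close> by (simp add: marked_chain_def successively_append_iff)
      then show "(1 - param M t p) * x $ q \<le> ?y $ p" using L ps(6) by metis
    qed
  next
    assume R: ?R
    show ?L
    proof (intro allI impI)
      fix ps p assume c: "marked_chain M ps p"
      then have "chain_sum t ?y ps \<le> x $ last ps"
        using assms by (intro chain_sum_le) (auto simp: marked_chain_def successively_append_iff)
      then have "(1 - param M t p) * chain_sum t ?y ps \<le> (1 - param M t p) * x $ last ps"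
        using assms[of p] by (intro mult_left_mono) (auto simp: param_def)
      also have "\<dots> \<le> ?y $ p"
        using R c by (auto simp: marked_chain_def successively_append_iff)
      finally show "(1 - param M t p) * chain_sum t ?y ps \<le> ?y $ p" .
    qed
  qed
  then show ?thesis
    by (simp add: marked_poset_polyhedron_def chain_sum_def transfer_map_marked)
qed

lemma order_polyhedron_iff:
  "x \<in> marked_order_polyhedron M lam \<longleftrightarrow>
    (\<forall>a\<in>M. x $ a = lam a) \<and> (\<forall>q p. q \<prec>\<^sub>c p \<longrightarrow> x $ q \<le> x $ p)"
  using transfer_map_in_polyhedron_iff[of "\<lambda>_. 0" x]
  by (simp add: transfer_map_zero marked_order_polyhedron_def param_def)

text \<open>For unmarked \<open>p\<close> the binding cover is an argmax \<open>z\<close>, since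
  \<open>1 - t p\<close> is positive. There the inequality reads
  \<open>(1 - t p) * x $ z \<le> x $ p - t p * x $ z\<close>, which is just
  \<open>x $ z \<le> x $ p\<close>.\<close>

lemma transfer_map_in_polyhedron_iff_order:
  assumes t: "\<And>p. p \<notin> M \<Longrightarrow> 0 \<le> t p \<and> t p < 1"
  shows "transfer_map M t x \<in> marked_poset_polyhedron M lam t \<longleftrightarrow>
    x \<in> marked_order_polyhedron M lam"
proof -
  have "(\<forall>q. q \<prec>\<^sub>c p \<longrightarrow> (1 - param M t p) * x $ q \<le> transfer_map M t x $ p) \<longleftrightarrow>
      (\<forall>q. q \<prec>\<^sub>c p \<longrightarrow> x $ q \<le> x $ p)" for p
  proof (cases "p \<in> M")
    case True
    then show ?thesis by (simp add: param_def transfer_map_marked)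
  next
    case False
    then obtain z where z: "z \<in> tc x p" using unmarked_tc_nonempty by blast
    have "(1 - t p) * x $ q \<le> x $ p - t p * x $ z"
      if "q \<prec>\<^sub>c p" "x $ z \<le> x $ p" for q
    proof -
      have "(1 - t p) * x $ q \<le> (1 - t p) * x $ z"
        using that z t[OF False] by (intro mult_left_mono) (auto simp: tc_iff)
      then show ?thesis using that by (simp add: algebra_simps)
    qed
    moreover have "x $ z \<le> x $ p" if "(1 - t p) * x $ z \<le> x $ p - t p * x $ z"
      using that by (simp add: algebra_simps)
    ultimately show ?thesis
      using z False by (simp add: param_def transfer_map_tc[OF False z] tc_iff) (meson order_trans)
  qed
  then show ?thesis
    using transfer_map_in_polyhedron_iff[of t x] t unfolding order_polyhedron_iff by blast
qed

text \<open>The equation for coordinate \<open>p\<close> involves only \<open>p\<close> and its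
  lower covers, so a preimage is built by well-founded recursion up the order.\<close>

lemma surj_transfer_map: "surj (transfer_map M t)"
proof (rule surjI)
  fix y :: "(real, 'p) vec"
  let ?P = "\<lambda>f p r. r = (if p \<in> M then y $ p else y $ p + t p * Max (f ` {q. q \<prec>\<^sub>c p}))"
  have "\<exists>f. \<forall>p. ?P f p (f p)"
  proof (rule dependent_wf_choice[OF wf_less_finite])
    fix f g :: "'p \<Rightarrow> real" and p r
    assume "\<And>q. (q, p) \<in> {(q, p). q < p} \<Longrightarrow> f q = g q"
    then have "f ` {q. q \<prec>\<^sub>c p} = g ` {q. q \<prec>\<^sub>c p}"
      by (intro image_cong) (auto simp: covered_by_def)
    then show "?P f p r = ?P g p r" by simp
  qed auto
  then obtain f where f: "\<And>p. ?P f p (f p)" by blast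
  have "(transfer_map M t (\<chi> p. f p)) $ p = y $ p" for p
    using f[of p] by (auto simp: transfer_map_def)
  then have "transfer_map M t (\<chi> p. f p) = y" by (simp add: vec_eq_iff)
  then show "transfer_map M t (SOME x. transfer_map M t x = y) = y" by (rule someI)
qed

lemma inj_transfer_map: "inj (transfer_map M t)"
proof (rule injI)
  fix x x' :: "(real, 'p) vec" assume eq: "transfer_map M t x = transfer_map M t x'"
  have "x $ p = x' $ p" for p
  proof (induction p rule: order_induct)
    case (1 p)
    then have "(\<lambda>q. x $ q) ` {q. q \<prec>\<^sub>c p} = (\<lambda>q. x' $ q) ` {q. q \<prec>\<^sub>c p}"
      by (intro image_cong) (auto simp: covered_by_def)
    moreover have "transfer_map M t x $ p = transfer_map M t x' $ p" using eq by simp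
    ultimately show ?case by (auto simp: transfer_map_def split: if_splits)
  qed
  then show "x = x'" by (simp add: vec_eq_iff)
qed

subsection \<open>Vertices of the tropical subdivision\<close>

text \<open>Strict cover inequalities survive small \<open>s\<close>, and tight ones stay tight
  because \<open>w\<close> is constant along them.\<close>

lemma compatible_perturbation:
  assumes x: "x \<in> marked_order_polyhedron M lam" and w: "compatible M x w"
  obtains e where "e > 0"
    and "\<And>s. \<bar>s\<bar> \<le> e \<Longrightarrow> x + s *\<^sub>R w \<in> marked_order_polyhedron M lam"
    and "\<And>s r. \<bar>s\<bar> \<le> e \<Longrightarrow> r \<notin> M \<Longrightarrow> tc x r \<subseteq> tc (x + s *\<^sub>R w) r"
proof -
  obtain e where e: "e > 0" "\<And>s q p. \<bar>s\<bar> \<le> e \<Longrightarrow> x $ q < x $ p \<Longrightarrow>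
      (x + s *\<^sub>R w) $ q < (x + s *\<^sub>R w) $ p"
    using strict_order_stable[of x w] by blast
  have "x + s *\<^sub>R w \<in> marked_order_polyhedron M lam" if s: "\<bar>s\<bar> \<le> e" for s
    unfolding order_polyhedron_iff
  proof (intro conjI allI impI ballI)
    fix a assume "a \<in> M"
    then show "(x + s *\<^sub>R w) $ a = lam a"
      using x w by (simp add: order_polyhedron_iff compatible_def)
  next
    fix q p :: 'p assume qp: "q \<prec>\<^sub>c p"
    show "(x + s *\<^sub>R w) $ q \<le> (x + s *\<^sub>R w) $ p"
    proof (cases "x $ q < x $ p")
      case True
      then show ?thesis using e(2)[OF s] by (intro less_imp_le)
    next
      case False
      then have "x $ q = x $ p" using x qp by (force simp: order_polyhedron_iff)
      then show ?thesis using w qp by (simp add: compatible_def)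
    qed
  qed
  moreover have "tc x r \<subseteq> tc (x + s *\<^sub>R w) r" if "\<bar>s\<bar> \<le> e" "r \<notin> M" for s r
    using tc_subset_perturbed[OF w] e(2) that by blast
  ultimately show thesis using that e(1) by blast
qed

lemma convex_order_polyhedron: "convex (marked_order_polyhedron M lam)"
  by (auto simp: convex_def order_polyhedron_iff distrib_right[symmetric]
      intro!: add_mono mult_left_mono)

text \<open>The slacks \<open>z $ p - z $ q\<close> are nonnegative on the polyhedron, so a slack
  that vanishes inside a segment vanishes at both ends. If \<open>x\<close> lies in the polyhedron,
  this is the smallest face containing it.\<close>

lemma tight_face:
  "{z \<in> marked_order_polyhedron M lam. \<forall>q p. q \<prec>\<^sub>c p \<longrightarrow> x $ q = x $ p \<longrightarrow> z $ q = z $ p}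
     face_of marked_order_polyhedron M lam" (is "?F face_of ?O")
  unfolding face_of_def
proof (intro conjI ballI impI)
  show "convex ?F"
    using convex_order_polyhedron unfolding convex_def by auto
  fix a b z assume a: "a \<in> ?O" and b: "b \<in> ?O" and z: "z \<in> ?F" "z \<in> open_segment a b"
  obtain u where u: "0 < u" "u < 1" "z = (1 - u) *\<^sub>R a + u *\<^sub>R b"
    using z(2) by (auto simp: in_segment)
  have "a $ q = a $ p \<and> b $ q = b $ p" if qp: "q \<prec>\<^sub>c p" "x $ q = x $ p" for q p
  proof -
    have "a $ q \<le> a $ p" "b $ q \<le> b $ p" using a b qp by (auto simp: order_polyhedron_iff)
    moreover have "(1 - u) * (a $ p - a $ q) + u * (b $ p - b $ q) = 0"
      using z(1) qp u(3) by (auto simp: algebra_simps)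
    moreover have "0 \<le> (1 - u) * (a $ p - a $ q)" "0 \<le> u * (b $ p - b $ q)"
      using calculation(1,2) u by auto
    ultimately have "(1 - u) * (a $ p - a $ q) = 0" "u * (b $ p - b $ q) = 0" by linarith+
    then show ?thesis using u by auto
  qed
  then show "a \<in> ?F" "b \<in> ?F" using a b by auto
qed auto

text \<open>A nonzero compatible direction would give a second point of the cell: the face
  \<open>F\<close> contains both ends of a segment through \<open>x\<close>, and \<open>G\<close> is
  not left because argmax sets only grow under the perturbation.\<close>

lemma singleton_cell_imp_rigid:
  assumes "F face_of marked_order_polyhedron M lam"
    and "G \<in> tropical_arrangement_subdivision M" and FG: "F \<inter> G = {x}"
  shows "rigid M x"
  unfolding rigid_def
proof (intro allI impI, rule ccontr)
  fix w assume w: "compatible M x w" "w \<noteq> 0"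
  have x: "x \<in> F" "x \<in> G" using FG by auto
  then have xO: "x \<in> marked_order_polyhedron M lam" using assms(1) face_of_imp_subset by blast
  \<comment> \<open>Containing \<open>x\<close>, the set \<open>G\<close> is a genuine cell and not
    the added empty set.\<close>
  obtain v where G: "G = tropical_cell M (tc v)"
    using assms(2) x(2) by (auto simp: tropical_arrangement_subdivision_def)
  obtain e where e: "e > 0"
    "\<And>s. \<bar>s\<bar> \<le> e \<Longrightarrow> x + s *\<^sub>R w \<in> marked_order_polyhedron M lam"
    "\<And>s r. \<bar>s\<bar> \<le> e \<Longrightarrow> r \<notin> M \<Longrightarrow> tc x r \<subseteq> tc (x + s *\<^sub>R w) r"
    using compatible_perturbation[OF xO w(1)] by blast
  have "x \<in> open_segment (x + e *\<^sub>R w) (x - e *\<^sub>R w)"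
    using e(1) w(2) by (intro in_open_segment_symmetric) simp
  moreover have "x + e *\<^sub>R w \<in> marked_order_polyhedron M lam"
    "x - e *\<^sub>R w \<in> marked_order_polyhedron M lam"
    using e(1) e(2)[of e] e(2)[of "- e"] by auto
  ultimately have "x + e *\<^sub>R w \<in> F" using face_ofD[OF assms(1)] x(1) by blast
  moreover have "x + e *\<^sub>R w \<in> G"
    unfolding G tropical_cell_def
  proof (intro CollectI ballI)
    fix r assume "r \<in> branch_elements M"
    then have "tc v r \<subseteq> tc x r" "r \<notin> M"
      using x(2) by (auto simp: G tropical_cell_def branch_elements_def)
    then show "tc v r \<subseteq> tc (x + e *\<^sub>R w) r" using e(1) e(3)[of e r] by auto
  qed
  ultimately have "x + e *\<^sub>R w = x" using FG by blast
  then show False using e(1) w(2) by simp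
qed

text \<open>The cell used is the smallest one containing \<open>x\<close>. Any other point of it
  differs from \<open>x\<close> by a compatible direction.\<close>

lemma rigid_imp_singleton_cell:
  assumes x: "x \<in> marked_order_polyhedron M lam" and "rigid M x"
  shows "{x} \<in> tropical_subdivision_order M lam"
proof -
  let ?F = "{z \<in> marked_order_polyhedron M lam.
    \<forall>q p. q \<prec>\<^sub>c p \<longrightarrow> x $ q = x $ p \<longrightarrow> z $ q = z $ p}"
  let ?G = "tropical_cell M (tc x)"
  have "z = x" if z: "z \<in> ?F" "z \<in> ?G" for z
  proof -
    have "compatible M x (z - x)"
      unfolding compatible_def
    proof (intro conjI ballI allI impI)
      fix a assume "a \<in> M"
      then show "(z - x) $ a = 0" using x z(1) by (simp add: order_polyhedron_iff)
    next
      fix q p :: 'p assume "q \<prec>\<^sub>c p" "x $ q = x $ p"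
      then show "(z - x) $ q = (z - x) $ p" using z(1) by simp
    next
      fix r q q' assume r: "r \<notin> M" and q: "q \<in> tc x r" "q' \<in> tc x r"
      show "(z - x) $ q = (z - x) $ q'"
      proof (cases "r \<in> branch_elements M")
        case True
        then have "q \<in> tc z r" "q' \<in> tc z r" using z(2) q by (auto simp: tropical_cell_def)
        then have "z $ q = z $ q'" "x $ q = x $ q'"
          using q by (auto simp: tc_iff intro: order_antisym)
        then show ?thesis by simp
      next
        case False
        then have "card {q. q \<prec>\<^sub>c r} \<le> Suc 0" using r by (simp add: branch_elements_def)
        then have "q = q'" using q by (auto simp: tc_iff card_le_Suc0_iff_eq)
        then show ?thesis by simp
      qed
    qed
    then show ?thesis using assms(2) by (auto simp: rigid_def)
  qed
  moreover have "x \<in> ?F" "x \<in> ?G" using x by (auto simp: tropical_cell_def)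
  ultimately have "{x} = ?F \<inter> ?G" by blast
  moreover have "?G \<in> tropical_arrangement_subdivision M"
    by (simp add: tropical_arrangement_subdivision_def)
  ultimately show ?thesis
    unfolding tropical_subdivision_order_def using tight_face by (intro CollectI exI conjI)
qed

lemma singleton_tropical_cell_iff_rigid:
  "{x} \<in> tropical_subdivision_order M lam \<longleftrightarrow> x \<in> marked_order_polyhedron M lam \<and> rigid M x"
proof
  assume "{x} \<in> tropical_subdivision_order M lam"
  then obtain F G where FG: "F face_of marked_order_polyhedron M lam"
    "G \<in> tropical_arrangement_subdivision M" "F \<inter> G = {x}"
    unfolding tropical_subdivision_order_def by auto
  then show "x \<in> marked_order_polyhedron M lam \<and> rigid M x"
    using singleton_cell_imp_rigid[OF FG] face_of_imp_subset by blast
qed (use rigid_imp_singleton_cell in blast)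

end

subsection \<open>Vertices of the marked poset polyhedron\<close>

locale marked_poset_interior = marked_poset +
  fixes t :: "'a::{finite,order} \<Rightarrow> real"
  assumes t_pos: "p \<notin> M \<Longrightarrow> 0 < t p" and t_less_one: "p \<notin> M \<Longrightarrow> t p < 1"
begin

abbreviation "\<phi> \<equiv> transfer_map M t"

lemma transfer_map_in_iff:
  "\<phi> x \<in> marked_poset_polyhedron M lam t \<longleftrightarrow> x \<in> marked_order_polyhedron M lam"
  using t_pos t_less_one by (intro transfer_map_in_polyhedron_iff_order) (auto intro: less_imp_le)

lemma extreme_imp_rigid:
  assumes "\<phi> x extreme_point_of marked_poset_polyhedron M lam t"
  shows "rigid M x"
  unfolding rigid_def
proof (intro allI impI, rule ccontr)
  fix w assume w: "compatible M x w" "w \<noteq> 0"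
  have xO: "x \<in> marked_order_polyhedron M lam"
    using assms transfer_map_in_iff by (auto simp: extreme_point_of_def)
  obtain e where e: "e > 0"
    "\<And>s. \<bar>s\<bar> \<le> e \<Longrightarrow> x + s *\<^sub>R w \<in> marked_order_polyhedron M lam"
    "\<And>s r. \<bar>s\<bar> \<le> e \<Longrightarrow> r \<notin> M \<Longrightarrow> tc x r \<subseteq> tc (x + s *\<^sub>R w) r"
    using compatible_perturbation[OF xO w(1)] by blast
  \<comment> \<open>The directional derivative of the transfer map. Any argmax of \<open>x\<close>
    may be chosen, since it remains an argmax at \<open>x + s *\<^sub>R w\<close>.\<close>
  define v where "v = (\<chi> p. if p \<in> M then w $ p else w $ p - t p * w $ (SOME q. q \<in> tc x p))"
  have lin: "\<phi> (x + s *\<^sub>R w) = \<phi> x + s *\<^sub>R v" if s: "\<bar>s\<bar> \<le> e" for s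
  proof -
    have "\<phi> (x + s *\<^sub>R w) $ p = (\<phi> x + s *\<^sub>R v) $ p" for p
    proof (cases "p \<in> M")
      case True
      then show ?thesis by (simp add: transfer_map_marked v_def)
    next
      case False
      let ?q = "SOME q. q \<in> tc x p"
      have q: "?q \<in> tc x p" using unmarked_tc_nonempty[OF False] by (rule someI_ex)
      then have "?q \<in> tc (x + s *\<^sub>R w) p" using e(3)[OF s False] by blast
      then show ?thesis
        using False q by (simp add: transfer_map_tc v_def algebra_simps)
    qed
    then show ?thesis by (simp add: vec_eq_iff)
  qed
  have "v \<noteq> 0"
  proof
    assume "v = 0"
    then have "\<phi> (x + e *\<^sub>R w) = \<phi> x" using lin[of e] e(1) by simp
    then show False using injD[OF inj_transfer_map] e(1) w(2) by fastforce
  qed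
  then have "\<phi> x \<in> open_segment (\<phi> x + e *\<^sub>R v) (\<phi> x - e *\<^sub>R v)"
    using e(1) by (intro in_open_segment_symmetric) simp
  moreover have "\<phi> x + s *\<^sub>R v \<in> marked_poset_polyhedron M lam t" if "\<bar>s\<bar> \<le> e" for s
    using that e(2) lin transfer_map_in_iff by metis
  from this[of e] this[of "- e"]
  have "\<phi> x + e *\<^sub>R v \<in> marked_poset_polyhedron M lam t"
    "\<phi> x - e *\<^sub>R v \<in> marked_poset_polyhedron M lam t"
    using e(1) by auto
  ultimately show False using assms unfolding extreme_point_of_def by blast
qed

text \<open>The inverse adds \<open>t p\<close> times a maximum to the coordinate at
  \<open>p\<close>, and convexity passes up the order because \<open>t p\<close> is nonnegative. An
  argmax \<open>q\<close> of \<open>x\<close> suffices: for \<open>A\<close> and \<open>B\<close>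
  only the bound of \<open>transfer_map_le\<close> at \<open>q\<close> enters.\<close>

lemma inverse_transfer_map_convex:
  assumes "0 \<le> u" "u \<le> 1" and eq: "\<phi> x = (1 - u) *\<^sub>R \<phi> A + u *\<^sub>R \<phi> B"
  shows "x $ p \<le> (1 - u) * A $ p + u * B $ p"
proof (induction p rule: order_induct)
  case (1 p)
  have eqp: "\<phi> x $ p = (1 - u) * \<phi> A $ p + u * \<phi> B $ p" using eq by simp
  show ?case
  proof (cases "p \<in> M")
    case True
    then show ?thesis using eqp by (simp add: transfer_map_marked)
  next
    case False
    then obtain q where q: "q \<in> tc x p" using unmarked_tc_nonempty by blast
    then have qp: "q \<prec>\<^sub>c p" by (simp add: tc_iff)
    have tp: "0 \<le> t p" using t_pos[OF False] by simp
    have "x $ q \<le> (1 - u) * A $ q + u * B $ q" using 1 qp by (simp add: covered_by_def)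
    then have "t p * x $ q \<le> t p * ((1 - u) * A $ q + u * B $ q)"
      using tp by (rule mult_left_mono)
    moreover have "(1 - u) * \<phi> A $ p \<le> (1 - u) * (A $ p - t p * A $ q)"
      "u * \<phi> B $ p \<le> u * (B $ p - t p * B $ q)"
      using assms(1,2) transfer_map_le[of p M q t, OF False qp tp] by (auto intro!: mult_left_mono)
    ultimately show ?thesis
      using eqp transfer_map_tc[OF False q, of t] by (simp add: algebra_simps)
  qed
qed

lemma rigid_imp_extreme:
  assumes xO: "x \<in> marked_order_polyhedron M lam" and rigid: "rigid M x"
  shows "\<phi> x extreme_point_of marked_poset_polyhedron M lam t"
  unfolding extreme_point_of_def
proof (intro conjI ballI notI)
  show "\<phi> x \<in> marked_poset_polyhedron M lam t" using xO transfer_map_in_iff by blast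
  fix a b
  assume ab: "a \<in> marked_poset_polyhedron M lam t" "b \<in> marked_poset_polyhedron M lam t"
    and seg: "\<phi> x \<in> open_segment a b"
  obtain A B where AB: "a = \<phi> A" "b = \<phi> B" using surj_transfer_map by (metis surjD)
  have AO: "A \<in> marked_order_polyhedron M lam" and BO: "B \<in> marked_order_polyhedron M lam"
    using ab AB transfer_map_in_iff by auto
  obtain u where u: "0 < u" "u < 1" and eq: "\<phi> x = (1 - u) *\<^sub>R \<phi> A + u *\<^sub>R \<phi> B"
    and "a \<noteq> b"
    using seg AB by (auto simp: in_segment)
  define X where "X = (1 - u) *\<^sub>R A + u *\<^sub>R B"
  have X: "X $ p = (1 - u) * A $ p + u * B $ p" for p by (simp add: X_def)
  have le: "x $ p \<le> X $ p" for p
    using inverse_transfer_map_convex[OF _ _ eq] u by (simp add: X)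
  have eqp: "\<phi> x $ p = (1 - u) * \<phi> A $ p + u * \<phi> B $ p" for p using eq by simp
  \<comment> \<open>Two weak inequalities whose combination with positive weights is reversed are
    both equalities.\<close>
  have combine: "c = c' \<and> d = d'"
    if "c \<le> c'" "d \<le> d'" "(1 - u) * c' + u * d' \<le> (1 - u) * c + u * d" for c c' d d' :: real
  proof -
    have "(1 - u) * c \<le> (1 - u) * c'" "u * d \<le> u * d'"
      using that u by (auto intro!: mult_left_mono)
    then have "(1 - u) * c = (1 - u) * c'" "u * d = u * d'" using that(3) by linarith+
    then show ?thesis using u by auto
  qed
  have marked: "A $ p = x $ p \<and> B $ p = x $ p" if "p \<in> M" for p
    using that xO AO BO by (simp add: order_polyhedron_iff)
  \<comment> \<open>Equality at \<open>p\<close> and cancellation of \<open>t p > 0\<close> make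
    \<open>x $ q\<close> the weighted mean of the maxima of \<open>A\<close> and \<open>B\<close>
    below \<open>p\<close>. As \<open>x $ q \<le> X $ q\<close>, the element \<open>q\<close> must
    attain both maxima.\<close>
  have down: "X $ q = x $ q \<and> q \<in> tc A p \<and> q \<in> tc B p"
    if p: "p \<notin> M" "X $ p = x $ p" and q: "q \<in> tc x p" for p q
  proof -
    obtain qA qB where qA: "qA \<in> tc A p" and qB: "qB \<in> tc B p"
      using unmarked_tc_nonempty p(1) by meson
    have "\<phi> x $ p = x $ p - t p * x $ q" "\<phi> A $ p = A $ p - t p * A $ qA"
      "\<phi> B $ p = B $ p - t p * B $ qB"
      using transfer_map_tc p(1) q qA qB by blast+
    then have "t p * x $ q = t p * ((1 - u) * A $ qA + u * B $ qB)"
      using eqp[of p] p(2) X[of p] by (simp add: algebra_simps)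
    then have xq: "x $ q = (1 - u) * A $ qA + u * B $ qB" using t_pos[OF p(1)] by simp
    have "A $ q \<le> A $ qA" "B $ q \<le> B $ qB" using q qA qB by (auto simp: tc_iff)
    moreover have "(1 - u) * A $ qA + u * B $ qB \<le> (1 - u) * A $ q + u * B $ q"
      using le[of q] xq X by simp
    ultimately have "A $ q = A $ qA" "B $ q = B $ qB" using combine by blast+
    then show ?thesis using q qA qB xq X[of q] by (auto simp: tc_iff)
  qed
  \<comment> \<open>For marked \<open>p\<close>,
    \<open>x $ q \<le> X $ q \<le> X $ p = x $ p\<close> closes up. For unmarked \<open>p\<close>,
    the inequality \<open>(1 - t p) * z $ q \<le> \<phi> z $ p\<close> holds for
    \<open>z = A\<close> and \<open>z = B\<close> and is an equality for \<open>z = x\<close>, so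
    \<open>combine\<close> makes it an equality for both.\<close>
  have tight: "X $ p = x $ p \<and> X $ q = x $ q \<and> A $ q = A $ p \<and> B $ q = B $ p"
    if qp: "q \<prec>\<^sub>c p" "x $ q = x $ p" for q p
  proof -
    have AqBq: "A $ q \<le> A $ p" "B $ q \<le> B $ p" using AO BO qp by (auto simp: order_polyhedron_iff)
    show ?thesis
    proof (cases "p \<in> M")
      case True
      have "(1 - u) * A $ p + u * B $ p = x $ p" using marked[OF True] by (simp add: algebra_simps)
      then have "A $ q = A $ p \<and> B $ q = B $ p"
        using AqBq le[of q] qp(2) X[of q] by (intro combine) auto
      then show ?thesis using X[of q] X[of p] marked[OF True] qp(2) by (simp add: algebra_simps)
    next
      case False
      have "x $ q' \<le> x $ p" if "q' \<prec>\<^sub>c p" for q'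
        using that xO by (auto simp: order_polyhedron_iff)
      \<comment> \<open>A tight lower cover is an argmax, since \<open>x $ p\<close> bounds all
        lower covers.\<close>
      then have q: "q \<in> tc x p" using qp by (auto simp: tc_iff)
      obtain qA qB where qA: "qA \<in> tc A p" and qB: "qB \<in> tc B p"
        using unmarked_tc_nonempty False by meson
      have \<phi>: "\<phi> x $ p = x $ p - t p * x $ q" "\<phi> A $ p = A $ p - t p * A $ qA"
        "\<phi> B $ p = B $ p - t p * B $ qB"
        using transfer_map_tc False q qA qB by blast+
      have t1: "0 < 1 - t p" using t_less_one[OF False] by simp
      have les: "A $ q \<le> A $ qA" "B $ q \<le> B $ qB" "A $ qA \<le> A $ p" "B $ qB \<le> B $ p"
        using qp qA qB AO BO by (auto simp: tc_iff order_polyhedron_iff)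
      have "(1 - t p) * A $ q \<le> (1 - t p) * A $ qA" "(1 - t p) * B $ q \<le> (1 - t p) * B $ qB"
        using les t1 by (auto intro!: mult_left_mono)
      moreover have "(1 - t p) * A $ qA \<le> \<phi> A $ p" "(1 - t p) * B $ qB \<le> \<phi> B $ p"
        using les \<phi> by (auto simp: algebra_simps)
      ultimately have ch: "(1 - t p) * A $ q \<le> \<phi> A $ p" "(1 - t p) * B $ q \<le> \<phi> B $ p"
        by linarith+
      have "(1 - t p) * x $ q \<le> (1 - t p) * X $ q" using le t1 by (intro mult_left_mono) auto
      moreover have "(1 - t p) * x $ q = (1 - u) * \<phi> A $ p + u * \<phi> B $ p"
        using eqp[of p] \<phi>(1) qp(2) by (simp add: algebra_simps)
      ultimately have "(1 - u) * \<phi> A $ p + u * \<phi> B $ p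
          \<le> (1 - u) * ((1 - t p) * A $ q) + u * ((1 - t p) * B $ q)"
        using X[of q] by (simp add: algebra_simps)
      then have e: "(1 - t p) * A $ q = \<phi> A $ p \<and> (1 - t p) * B $ q = \<phi> B $ p"
        using ch combine by blast
      then have "(1 - t p) * A $ q = (1 - t p) * A $ qA" "(1 - t p) * B $ q = (1 - t p) * B $ qB"
        using \<open>(1 - t p) * A $ qA \<le> \<phi> A $ p\<close> \<open>(1 - t p) * B $ qB \<le> \<phi> B $ p\<close>
          \<open>(1 - t p) * A $ q \<le> (1 - t p) * A $ qA\<close> \<open>(1 - t p) * B $ q \<le> (1 - t p) * B $ qB\<close>
        by linarith+
      then have qAB: "A $ q = A $ qA" "B $ q = B $ qB" using t1 by auto
      then have AB: "A $ q = A $ p" "B $ q = B $ p" using e \<phi> by (auto simp: algebra_simps)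
      have "(1 - t p) * x $ q = (1 - u) * \<phi> A $ p + u * \<phi> B $ p" by fact
      also have "\<dots> = (1 - u) * ((1 - t p) * A $ q) + u * ((1 - t p) * B $ q)" using e by simp
      also have "\<dots> = (1 - t p) * X $ q" unfolding X by algebra
      finally have "(1 - t p) * x $ q = (1 - t p) * X $ q" .
      then have "X $ q = x $ q" using t1 by simp
      then show ?thesis using AB X[of p] X[of q] qp(2) by simp
    qed
  qed
  \<comment> \<open>Induction from the top. An unmarked \<open>p\<close> either lies on a tight
    cover, where \<open>tight\<close> applies at once, or is an argmax below some unmarked
    \<open>s\<close>, where equality at \<open>s\<close> is passed down.\<close>
  have good: "X $ p = x $ p" for p
  proof (induction p rule: order_induct_up)
    case (1 p)
    show ?case
    proof (cases "p \<in> M")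
      case True
      then show ?thesis using marked X[of p] by (simp add: algebra_simps)
    next
      case False
      from rigid False show ?thesis
      proof (cases rule: rigid_unmarked_edge)
        case (3 s)
        then have "p < s" by (simp add: tc_iff covered_by_def)
        then show ?thesis using 1 down 3 by blast
      qed (use tight in blast)+
    qed
  qed
  have "compatible M x (A - B)"
    unfolding compatible_def
  proof (intro conjI ballI allI impI)
    show "(A - B) $ p = 0" if "p \<in> M" for p using marked[OF that] by simp
    show "(A - B) $ q = (A - B) $ p" if "q \<prec>\<^sub>c p" "x $ q = x $ p" for q p
      using tight[OF that] by simp
    fix r q q' assume "r \<notin> M" "q \<in> tc x r" "q' \<in> tc x r"
    then have "q \<in> tc A r" "q' \<in> tc A r" "q \<in> tc B r" "q' \<in> tc B r" using down good by blast+
    then have "A $ q = A $ q'" "B $ q = B $ q'" by (auto simp: tc_iff intro: order_antisym)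
    then show "(A - B) $ q = (A - B) $ q'" by simp
  qed
  then have "A = B" using rigid by (auto simp: rigid_def)
  then show False using AB \<open>a \<noteq> b\<close> by simp
qed

lemma vertex_iff_rigid:
  "{\<phi> x} face_of marked_poset_polyhedron M lam t \<longleftrightarrow>
    x \<in> marked_order_polyhedron M lam \<and> rigid M x"
proof
  assume "{\<phi> x} face_of marked_poset_polyhedron M lam t"
  then have e: "\<phi> x extreme_point_of marked_poset_polyhedron M lam t"
    by (simp add: face_of_singleton)
  then have "\<phi> x \<in> marked_poset_polyhedron M lam t" by (simp add: extreme_point_of_def)
  then show "x \<in> marked_order_polyhedron M lam \<and> rigid M x"
    using e extreme_imp_rigid transfer_map_in_iff by blast
qed (simp add: face_of_singleton rigid_imp_extreme)

lemma vertex_iff_tropical_vertex: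
  "{y} face_of marked_poset_polyhedron M lam t \<longleftrightarrow> {y} \<in> tropical_subdivision M lam t"
proof -
  obtain x where y: "y = \<phi> x" using surj_transfer_map by (metis surjD)
  \<comment> \<open>Injectivity ensures that a one-point image can only come from a one-point
    cell.\<close>
  have "{y} = \<phi> ` Q \<longleftrightarrow> Q = {x}" for Q
    using inj_image_eq_iff[OF inj_transfer_map, of t "{x}" Q] y by auto
  then have "{y} \<in> tropical_subdivision M lam t \<longleftrightarrow> {x} \<in> tropical_subdivision_order M lam"
    by (simp add: tropical_subdivision_def image_iff)
  then show ?thesis
    using vertex_iff_rigid singleton_tropical_cell_iff_rigid y by simp
qed

end

theorem theorem5p1:
  fixes M :: "'p::{finite,order} set" and lam t :: "'p \<Rightarrow> real"
  assumes "mono_on M lam"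
    and "\<And>p. (\<nexists>q. q < p) \<Longrightarrow> p \<in> M"
    and "\<And>p. p \<notin> M \<Longrightarrow> 0 < t p \<and> t p < 1"
  shows "{V. V face_of marked_poset_polyhedron M lam t \<and> aff_dim V = 0} =
         {Q \<in> tropical_subdivision M lam t. aff_dim Q = 0}"
proof -
  interpret marked_poset_interior M lam t
  proof unfold_locales
    show "p \<in> M" if "\<nexists>q. q < p" for p using assms(2)[OF that] .
    show "0 < t p" if "p \<notin> M" for p using assms(3)[OF that] ..
    show "t p < 1" if "p \<notin> M" for p using assms(3)[OF that] ..
  qed
  show ?thesis
  proof (intro Collect_cong)
    fix V :: "(real, 'p) vec set"
    show "V face_of marked_poset_polyhedron M lam t \<and> aff_dim V = 0 \<longleftrightarrow>
      V \<in> tropical_subdivision M lam t \<and> aff_dim V = 0"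
      unfolding aff_dim_eq_0 using vertex_iff_tropical_vertex by metis
  qed
qed

end
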